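(* With $x\vee y:=\ln(e^x+e^y)$ for real variables $x,y$, the following identities hold: (1) $\displaystyle \left[\frac{\partial}{\partial x}+\frac{\partial}{\partial y}\right](x\vee y)=1$; (2) $\displaystyle \nabla^2(x\vee y)=1-\left[\left(\frac{\partial}{\partial x}(x\vee y)\right)^2+\left(\frac{\partial}{\partial y}(x\vee y)\right)^2\right]$; (3) $\displaystyle \frac{\partial}{\partial x}\frac{\partial}{\partial y}(x\vee y)=\frac{\partial}{\partial y}\frac{\partial}{\partial x}(x\vee y)=\frac{-e^xe^y}{e^x+e^y}=-\exp\left[x+y-(x\vee y)\right]$; (4) $\displaystyle \left[\frac{\partial}{\partial x}\vee\frac{\partial}{\partial y}\right](xy)=x\vee y$; (5) $\displaystyle \left[\frac{\partial}{\partial x}\vee\frac{\partial}{\partial y}\right](x+y)=1\vee 1=1+\ln 2$; (6) $\displaystyle \left[\frac{\partial}{\partial x}\vee\frac{\partial}{\partial y}\right](x\vee y)=\frac{e^x}{e^x+e^y}\vee\frac{e^y}{e^x+e^y}$.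
   Context: For real $a,b$, the join is $a\vee b:=\ln(e^a+e^b)$. $\nabla^2=\frac{\partial^2}{\partial x^2}+\frac{\partial^2}{\partial y^2}$ is the Laplacian. For a differentiable function $f(x,y)$, $\left[\frac{\partial}{\partial x}+\frac{\partial}{\partial y}\right]f$ means $\frac{\partial f}{\partial x}+\frac{\partial f}{\partial y}$, and $\left[\frac{\partial}{\partial x}\vee\frac{\partial}{\partial y}\right]f$ means $\frac{\partial f}{\partial x}\vee\frac{\partial f}{\partial y}$.
   Formalization: Identity (3) is false as printed (at x=y=0 the mixed partial is −1/4, not −1/2); it is proved in the corrected form −e^x e^y/(e^x+e^y)^2 = −exp[x+y−2(x∨y)]. *)

theory Defs
  imports "HOL-Analysis.Analysis"
begin

definition join :: "real \<Rightarrow> real \<Rightarrow> real"  (infixl "\<curlyvee>" 65)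
  where "a \<curlyvee> b = ln (exp a + exp b)"

text \<open>Functions of two real variables are curried. The library's \<open>deriv\<close> is total, so an
  identity between partial derivatives alone does not assert that they exist.\<close>

definition partial_x :: "(real \<Rightarrow> real \<Rightarrow> real) \<Rightarrow> real \<Rightarrow> real \<Rightarrow> real"
  where "partial_x f x y = deriv (\<lambda>s. f s y) x"

definition partial_y :: "(real \<Rightarrow> real \<Rightarrow> real) \<Rightarrow> real \<Rightarrow> real \<Rightarrow> real"
  where "partial_y f x y = deriv (\<lambda>t. f x t) y"

definition laplacian :: "(real \<Rightarrow> real \<Rightarrow> real) \<Rightarrow> real \<Rightarrow> real \<Rightarrow> real"
  where "laplacian f x y = partial_x (partial_x f) x y + partial_y (partial_y f) x y"

definition partial_sum :: "(real \<Rightarrow> real \<Rightarrow> real) \<Rightarrow> real \<Rightarrow> real \<Rightarrow> real"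
  where "partial_sum f x y = partial_x f x y + partial_y f x y"

definition partial_join :: "(real \<Rightarrow> real \<Rightarrow> real) \<Rightarrow> real \<Rightarrow> real \<Rightarrow> real"
  where "partial_join f x y = partial_x f x y \<curlyvee> partial_y f x y"

definition differentiable2_at :: "(real \<Rightarrow> real \<Rightarrow> real) \<Rightarrow> real \<Rightarrow> real \<Rightarrow> bool"
  where "differentiable2_at f x y \<longleftrightarrow> (\<lambda>(s, t). f s t) differentiable (at (x, y))"

end

theory Submission
  imports Defs
begin

text \<open>The first partials of the join are the weights p =
  \<open>exp x / (exp x + exp y)\<close> and q = \<open>exp y / (exp x + exp y)\<close>, with p + q
  = 1 (\<open>partial_x_join\<close>, \<open>partial_y_join\<close>,
  \<open>partial_sum_join\<close>). These are logistic functions of x - y and y - x, so each pure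
  second partial is pq and each mixed one is -pq. Squaring p + q = 1 gives 2pq = 1 - (p^2 + q^2),
  the Laplacian identity. The joins of partials follow by substituting the first partials.\<close>

lemma exp_add_exp_pos: "exp x + exp y > (0::real)"
  by (intro add_pos_pos exp_gt_zero)

lemma exp_add_exp_neq_0: "exp x + exp y \<noteq> (0::real)"
  using exp_add_exp_pos[of x y] by linarith

lemma exp_join: "exp (x \<curlyvee> y) = exp x + exp y"
  by (simp add: join_def exp_add_exp_pos)

text \<open>The partials of \<open>x * y\<close> are y and x, in this order, so their join first
  appears as \<open>y \<curlyvee> x\<close>.\<close>

lemma join_commute: "x \<curlyvee> y = y \<curlyvee> x"
  by (simp add: join_def add.commute)

lemma join_self: "a \<curlyvee> a = a + ln 2"
proof -
  have "exp a + exp a = exp a * 2" by simp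
  then show ?thesis unfolding join_def by (simp only: ln_mult exp_gt_zero ln_exp) (simp add: ln_mult)
qed

text \<open>An equation between functions rather than values, so that it can be rewritten under a
  second partial derivative.\<close>

lemma partial_x_join: "partial_x (\<lambda>x y. x \<curlyvee> y) = (\<lambda>x y. exp x / (exp x + exp y))"
  unfolding partial_x_def join_def
  by (intro ext DERIV_imp_deriv)
    (auto intro!: derivative_eq_intros simp: exp_add_exp_pos)

lemma partial_y_join: "partial_y (\<lambda>x y. x \<curlyvee> y) = (\<lambda>x y. exp y / (exp x + exp y))"
  unfolding partial_y_def join_def
  by (intro ext DERIV_imp_deriv)
    (auto intro!: derivative_eq_intros simp: exp_add_exp_pos)

text \<open>The logistic equation: the x-derivative of p is p(1 - p) = pq.\<close>

lemma partial_x_partial_x_join: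
  "partial_x (partial_x (\<lambda>x y. x \<curlyvee> y)) x y = exp x * exp y / (exp x + exp y)^2"
  unfolding partial_x_join unfolding partial_x_def
  by (intro DERIV_imp_deriv)
    (auto intro!: derivative_eq_intros
      simp: exp_add_exp_neq_0 power2_eq_square algebra_simps)

lemma partial_y_partial_y_join:
  "partial_y (partial_y (\<lambda>x y. x \<curlyvee> y)) x y = exp x * exp y / (exp x + exp y)^2"
  unfolding partial_y_join unfolding partial_y_def
  by (intro DERIV_imp_deriv)
    (auto intro!: derivative_eq_intros
      simp: exp_add_exp_neq_0 power2_eq_square algebra_simps)

text \<open>Since q = 1 - p, its x-derivative is the negative of that of p.\<close>

lemma partial_x_partial_y_join:
  "partial_x (partial_y (\<lambda>x y. x \<curlyvee> y)) x y = - (exp x * exp y) / (exp x + exp y)^2"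
  unfolding partial_y_join unfolding partial_x_def
  by (intro DERIV_imp_deriv)
    (auto intro!: derivative_eq_intros
      simp: exp_add_exp_neq_0 power2_eq_square algebra_simps)

lemma partial_y_partial_x_join:
  "partial_y (partial_x (\<lambda>x y. x \<curlyvee> y)) x y = - (exp x * exp y) / (exp x + exp y)^2"
  unfolding partial_x_join unfolding partial_y_def
  by (intro DERIV_imp_deriv)
    (auto intro!: derivative_eq_intros
      simp: exp_add_exp_neq_0 power2_eq_square algebra_simps)

text \<open>Both orders have the same explicit value, so symmetry is read off without Schwarz's
  theorem.\<close>

lemma mixed_partials_join:
  "partial_x (partial_y (\<lambda>x y. x \<curlyvee> y)) x y = partial_y (partial_x (\<lambda>x y. x \<curlyvee> y)) x y"
  by (rule trans[OF partial_x_partial_y_join partial_y_partial_x_join[symmetric]])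

lemma partial_mult:
  "partial_x (\<lambda>x y. x * y) x y = y" "partial_y (\<lambda>x y. x * y) x y = x"
  unfolding partial_x_def partial_y_def
  by (auto intro!: DERIV_imp_deriv derivative_eq_intros)

lemma partial_add:
  "partial_x (\<lambda>x y. x + y) x y = 1" "partial_y (\<lambda>x y. x + y) x y = 1"
  unfolding partial_x_def partial_y_def
  by (auto intro!: DERIV_imp_deriv derivative_eq_intros)

lemma differentiable2_join: "differentiable2_at (\<lambda>x y. x \<curlyvee> y) x y"
  unfolding differentiable2_at_def differentiable_def join_def case_prod_beta
  \<comment> \<open>The witness derivative stays schematic and is assembled by the differentiation
    rules.\<close>
  by (rule exI, (rule derivative_eq_intros refl | simp add: exp_add_exp_pos)+)

text \<open>Guarantees that the second partials are genuine derivatives, not arbitrary values of the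
  total \<open>deriv\<close>.\<close>

lemma differentiable2_partial_x_join: "differentiable2_at (partial_x (\<lambda>x y. x \<curlyvee> y)) x y"
  unfolding partial_x_join differentiable2_at_def differentiable_def case_prod_beta
  by (rule exI, (rule derivative_eq_intros refl | simp add: exp_add_exp_neq_0)+)

lemma differentiable2_partial_y_join: "differentiable2_at (partial_y (\<lambda>x y. x \<curlyvee> y)) x y"
  unfolding partial_y_join differentiable2_at_def differentiable_def case_prod_beta
  by (rule exI, (rule derivative_eq_intros refl | simp add: exp_add_exp_neq_0)+)

lemma differentiable2_mult: "differentiable2_at (\<lambda>x y. x * y) x y"
  unfolding differentiable2_at_def differentiable_def case_prod_beta
  by (rule exI, (rule derivative_eq_intros refl)+)

lemma differentiable2_add: "differentiable2_at (\<lambda>x y. x + y) x y"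
  unfolding differentiable2_at_def differentiable_def case_prod_beta
  by (rule exI, (rule derivative_eq_intros refl)+)

lemma partial_sum_join: "partial_sum (\<lambda>x y. x \<curlyvee> y) x y = 1"
  by (simp add: partial_sum_def partial_x_join partial_y_join exp_add_exp_neq_0
      flip: add_divide_distrib)

lemma laplacian_join:
  "laplacian (\<lambda>x y. x \<curlyvee> y) x y
    = 1 - ((partial_x (\<lambda>x y. x \<curlyvee> y) x y)^2 + (partial_y (\<lambda>x y. x \<curlyvee> y) x y)^2)"
proof -
  let ?p = "exp x / (exp x + exp y)" and ?q = "exp y / (exp x + exp y)"
  have "?p + ?q = 1"
    using partial_sum_join[of x y] by (simp add: partial_sum_def partial_x_join partial_y_join)
  \<comment> \<open>This is (p + q)^2 = 1 expanded; the left side is the sum of the two pure second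
    partials.\<close>
  then have "2 * (?p * ?q) = 1 - (?p^2 + ?q^2)"
    by algebra
  then show ?thesis
    unfolding laplacian_def partial_x_partial_x_join partial_y_partial_y_join
    by (simp add: partial_x_join partial_y_join power2_eq_square)
qed

text \<open>The factor 2 matches the squared denominator, as \<open>exp (x \<curlyvee> y)\<close> is
  \<open>exp x + exp y\<close>.\<close>

lemma exp_diff_two_join: "exp (x + y - 2 * (x \<curlyvee> y)) = exp x * exp y / (exp x + exp y)^2"
  by (simp add: exp_diff exp_add exp_double exp_join)

text \<open>The mixed partial is stated with a squared denominator and exponent
  \<open>x + y - 2 * (x \<curlyvee> y)\<close>. The unsquared formula with
  \<open>x + y - (x \<curlyvee> y)\<close> is false: at x = y = 0 it gives -1/2, while the mixed
  partial is -1/4. Differentiability is asserted separately because \<open>deriv\<close> is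
  total.\<close>

theorem theorem4p1:
  fixes x y :: real
  shows
    "(differentiable2_at (\<lambda>x y. x \<curlyvee> y) x y
      \<and> differentiable2_at (partial_x (\<lambda>x y. x \<curlyvee> y)) x y
      \<and> differentiable2_at (partial_y (\<lambda>x y. x \<curlyvee> y)) x y
      \<and> differentiable2_at (\<lambda>x y. x * y) x y
      \<and> differentiable2_at (\<lambda>x y. x + y) x y)
    \<and> partial_sum (\<lambda>x y. x \<curlyvee> y) x y = 1
    \<and> laplacian (\<lambda>x y. x \<curlyvee> y) x y
        = 1 - ((partial_x (\<lambda>x y. x \<curlyvee> y) x y)^2 + (partial_y (\<lambda>x y. x \<curlyvee> y) x y)^2)
    \<and> (partial_x (partial_y (\<lambda>x y. x \<curlyvee> y)) x y = partial_y (partial_x (\<lambda>x y. x \<curlyvee> y)) x y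
      \<and> partial_y (partial_x (\<lambda>x y. x \<curlyvee> y)) x y = - (exp x * exp y) / (exp x + exp y)^2
      \<and> - (exp x * exp y) / (exp x + exp y)^2 = - exp (x + y - 2 * (x \<curlyvee> y)))
    \<and> partial_join (\<lambda>x y. x * y) x y = x \<curlyvee> y
    \<and> (partial_join (\<lambda>x y. x + y) x y = 1 \<curlyvee> 1 \<and> 1 \<curlyvee> 1 = 1 + ln 2)
    \<and> partial_join (\<lambda>x y. x \<curlyvee> y) x y
        = (exp x / (exp x + exp y)) \<curlyvee> (exp y / (exp x + exp y))"
  by (intro conjI differentiable2_join differentiable2_partial_x_join
      differentiable2_partial_y_join differentiable2_mult differentiable2_add
      partial_sum_join laplacian_join mixed_partials_join
      partial_y_partial_x_join)
    (simp_all add: exp_diff_two_join partial_join_def partial_mult partial_add partial_x_join partial_y_join join_self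
      join_commute[of y x])

end
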